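(* In the two-walker linearly edge-reinforced random walk on the three-node segment with random walker selection, the fraction $$\frac{w(n,0)}{w(n,0)+w(n,1)}$$ converges almost surely as $n\to\infty$, and its limit is identical to the limit of $\frac{w(\tau_n,0)}{w(\tau_n,0)+w(\tau_n,1)}$ as $n\to\infty$.
   Context: Model (random walker selection): the graph is the segment with nodes $-1,0,1$ and edges $\{-1,0\}$ (left edge, weight $w(n,0)$ at time $n$) and $\{0,1\}$ (right edge, weight $w(n,1)$ at time $n$). Initially $w(0,0)=w(0,1)=1$. There are two walkers $X^{(1)},X^{(2)}$, both starting at node $0$. At every time step, one of the two walkers is chosen uniformly at random, independently of all other steps and of the past, and moves (the other stays): from node $-1$ or $1$ it moves back to node $0$; from node $0$, at time $n$, it moves to $-1$ with probability $\frac{w(n,0)}{w(n,0)+w(n,1)}$ and to $1$ with probability $\frac{w(n,1)}{w(n,0)+w(n,1)}$. The weight of the traversed edge is increased by $1$; the other weight is unchanged. Set $\tau_0=0$ and $\tau_n=\inf\{k>\tau_{n-1}: X^{(1)}_k=X^{(2)}_k=0\}$ for $n\ge 1$. *)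

theory Defs
  imports "HOL-Probability.Probability"
begin

text \<open>A configuration \<open>((x1, x2), (a, b))\<close> consists of the positions of the two walkers on the nodes
  -1, 0, 1 and of the weights of the left edge {-1,0} and of the right edge {0,1}.\<close>

type_synonym config = "(int \<times> int) \<times> (nat \<times> nat)"

definition jump :: "nat \<times> nat \<Rightarrow> int \<Rightarrow> int pmf" where
  "jump ab x =
     (if x = 0
      then map_pmf (\<lambda>right. if right then 1 else -1)
             (bernoulli_pmf (real (snd ab) / (real (fst ab) + real (snd ab))))
      else return_pmf 0)"

definition reinforce :: "int \<Rightarrow> int \<Rightarrow> nat \<times> nat \<Rightarrow> nat \<times> nat" where
  "reinforce x y ab =
     (if {x, y} = {-1, 0} then (fst ab + 1, snd ab)
      else if {x, y} = {0, 1} then (fst ab, snd ab + 1)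
      else ab)"

definition lerrw_step :: "config \<Rightarrow> config pmf" where
  "lerrw_step c =
     (case c of ((x1, x2), ab) \<Rightarrow>
        bind_pmf (pmf_of_set {1, 2 :: nat}) (\<lambda>i.
          if i = 1
          then map_pmf (\<lambda>y. ((y, x2), reinforce x1 y ab)) (jump ab x1)
          else map_pmf (\<lambda>y. ((x1, y), reinforce x2 y ab)) (jump ab x2)))"

text \<open>\<open>X1 n\<close> and \<open>X2 n\<close> are the positions at time \<open>n\<close>; \<open>w n 0\<close> and \<open>w n 1\<close> are the weights of the
  left and the right edge (\<open>w n e\<close> is irrelevant for other \<open>e\<close>). The law is prescribed by the
  conditional distribution of the next configuration given the whole past. The selected walker is
  not a separate variable because it is the one whose position changes; its being selected with
  probability 1/2 given the past is the required independence.\<close>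

locale two_walker_lerrw = prob_space M
  for M :: "'a measure" +
  fixes X1 X2 :: "nat \<Rightarrow> 'a \<Rightarrow> int"
    and w :: "nat \<Rightarrow> nat \<Rightarrow> 'a \<Rightarrow> nat"
  assumes measurable_X1: "\<And>n. X1 n \<in> measurable M (count_space UNIV)"
    and measurable_X2: "\<And>n. X2 n \<in> measurable M (count_space UNIV)"
    and measurable_w: "\<And>n e. e \<in> {0, 1} \<Longrightarrow> w n e \<in> measurable M (count_space UNIV)"
    and init: "AE \<omega> in M. X1 0 \<omega> = 0 \<and> X2 0 \<omega> = 0 \<and> w 0 0 \<omega> = 1 \<and> w 0 1 \<omega> = 1"
    and transition:
      "\<And>n (c :: nat \<Rightarrow> config).
         measure M {\<omega> \<in> space M. \<forall>k\<le>Suc n. ((X1 k \<omega>, X2 k \<omega>), (w k 0 \<omega>, w k 1 \<omega>)) = c k}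
         = measure M {\<omega> \<in> space M. \<forall>k\<le>n. ((X1 k \<omega>, X2 k \<omega>), (w k 0 \<omega>, w k 1 \<omega>)) = c k}
           * pmf (lerrw_step (c n)) (c (Suc n))"

definition left_fraction :: "(nat \<Rightarrow> nat \<Rightarrow> 'a \<Rightarrow> nat) \<Rightarrow> nat \<Rightarrow> 'a \<Rightarrow> real" where
  "left_fraction w n \<omega> = real (w n 0 \<omega>) / (real (w n 0 \<omega>) + real (w n 1 \<omega>))"

text \<open>The infimum is taken in \<^typ>\<open>enat\<close>, so that it is infinite over the empty set.\<close>

primrec tau :: "(nat \<Rightarrow> 'a \<Rightarrow> int) \<Rightarrow> (nat \<Rightarrow> 'a \<Rightarrow> int) \<Rightarrow> nat \<Rightarrow> 'a \<Rightarrow> enat" where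
  "tau X1 X2 0 \<omega> = 0"
| "tau X1 X2 (Suc n) \<omega> =
     Inf {enat k | k. tau X1 X2 n \<omega> < enat k \<and> X1 k \<omega> = 0 \<and> X2 k \<omega> = 0}"

end

(* Count every walker that sits at an outer node as if it had already returned, i.e. as one more
   traversal of its edge. Then only moves out of the node 0 change the resulting left fraction, the
   potential, and its conditional drift at time n is O(1/n^2), while its increments are O(1/n).
   Hence its squared increment over [n, n + k] has expectation O(k/n^2), which is O(1/j^4)
   for the increment D_j between j^3 and (j+1)^3. As |D_j| <= j^2 D_j^2 + 1/j^2, these increments are
   almost surely summable, so the potential converges along the cubes, and the deterministic
   bound O(1/n) on the increments fills the gaps, which have length O(j^2). The left fraction
   differs from the potential by O(1/n).

   The times tau_n are almost surely finite because the weight "homing" of a path killed when both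
   walkers are at 0 contracts by 3/4 in each step. *)
theory Submission imports Defs begin

section \<open>Potential of a configuration and one-step expectations\<close>

definition at_node :: "int \<Rightarrow> int \<Rightarrow> real" where
  "at_node y x = (if x = y then 1 else 0)"

definition potential :: "config \<Rightarrow> real" where
  "potential c = (case c of ((x1, x2), (a, b)) \<Rightarrow>
     (a + at_node (-1) x1 + at_node (-1) x2)
       / (a + b + at_node (-1) x1 + at_node (-1) x2 + at_node 1 x1 + at_node 1 x2))"

text \<open>The total weight is deterministic: 2 at the start and one more per step. This turns
  bounds in terms of the weights into bounds in \<open>n\<close>.\<close>

definition valid :: "nat \<Rightarrow> config \<Rightarrow> bool" where
  "valid n c = (case c of ((x1, x2), (a, b)) \<Rightarrow>
     x1 \<in> {-1, 0, 1} \<and> x2 \<in> {-1, 0, 1} \<and> a + b = n + 2)"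

lemma expectation_jump:
  "measure_pmf.expectation (jump (a, b) x) (g :: int \<Rightarrow> real)
   = (if x = 0 then b / (a + b) * g 1 + (1 - b / (a + b)) * g (-1) else g 0)"
proof -
  have "real b / (real a + real b) \<in> {0..1}"
    by (auto simp: divide_simps)
  then show ?thesis
    by (simp add: jump_def)
qed

lemma set_pmf_jump: "set_pmf (jump ab x) \<subseteq> (if x = 0 then {-1, 1} else {0})"
  by (auto simp: jump_def)

lemma expectation_lerrw_step:
  "measure_pmf.expectation (lerrw_step ((x1, x2), ab)) (f :: config \<Rightarrow> real)
   = (measure_pmf.expectation (jump ab x1) (\<lambda>y. f ((y, x2), reinforce x1 y ab))
      + measure_pmf.expectation (jump ab x2) (\<lambda>y. f ((x1, y), reinforce x2 y ab))) / 2"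
proof -
  have fin: "finite (set_pmf (jump ab x))" for x
    by (rule finite_subset[OF set_pmf_jump]) auto
  show ?thesis
    unfolding lerrw_step_def prod.case
    by (subst pmf_expectation_bind[where A = "{1, 2}"])
      (auto simp: fin pmf_of_set field_simps)
qed

lemma set_pmf_lerrw_step:
  "set_pmf (lerrw_step ((x1, x2), ab))
   = (\<lambda>y. ((y, x2), reinforce x1 y ab)) ` set_pmf (jump ab x1)
     \<union> (\<lambda>y. ((x1, y), reinforce x2 y ab)) ` set_pmf (jump ab x2)"
  by (auto simp: lerrw_step_def)

lemma finite_set_pmf_lerrw_step: "finite (set_pmf (lerrw_step c))"
proof -
  have fin: "finite (set_pmf (jump ab x))" for ab x
    by (rule finite_subset[OF set_pmf_jump]) auto
  obtain x1 x2 ab where "c = ((x1, x2), ab)"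
    by (metis prod.collapse)
  then show ?thesis
    by (simp add: set_pmf_lerrw_step fin)
qed

section \<open>Increments and drift of the potential\<close>

text \<open>The potential seen from the walker that moves, at \<open>x\<close>; \<open>u\<close> and
  \<open>v\<close> are the pending returns of the resting walker over the left and right edge, which
  stay fixed during the move. Both choices of the walker thus become one computation.\<close>

definition move_potential :: "int \<Rightarrow> nat \<times> nat \<Rightarrow> real \<Rightarrow> real \<Rightarrow> real" where
  "move_potential x ab u v =
     (real (fst ab) + at_node (-1) x + u)
       / (real (fst ab) + real (snd ab) + at_node (-1) x + at_node 1 x + u + v)"

lemma potential_eq_move_potential:
  "potential ((x1, x2), ab) = move_potential x1 ab (at_node (-1) x2) (at_node 1 x2)"
  "potential ((x1, x2), ab) = move_potential x2 ab (at_node (-1) x1) (at_node 1 x1)"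
  by (auto simp: potential_def move_potential_def algebra_simps split: prod.splits)

lemma potential_commute: "potential ((x1, x2), ab) = potential ((x2, x1), ab)"
  by (simp add: potential_eq_move_potential(1)[of x1] potential_eq_move_potential(2)[of x2])

text \<open>A departure from node 0 counts as the traversal together with its pending return, so the
  denominator grows by 2 and the numerator by 2 or 0.\<close>

lemma ratio_increment_bound:
  fixes A S e s :: real
  assumes "0 \<le> A" "A \<le> S" "0 < s" "s \<le> S" "e \<in> {0, 2}"
  shows "\<bar>(A + e) / (S + 2) - A / S\<bar> \<le> 2 / s"
proof -
  have "(A + e) / (S + 2) - A / S = (e - 2 * (A / S)) / (S + 2)"
    using assms by (simp add: field_simps)
  moreover have "\<bar>e - 2 * (A / S)\<bar> \<le> 2"
  proof -
    have "0 \<le> A / S" "A / S \<le> 1" using assms by auto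
    then show ?thesis using assms(5) by auto
  qed
  then have "\<bar>(e - 2 * (A / S)) / (S + 2)\<bar> \<le> 2 / (S + 2)"
    using assms by (simp add: abs_divide divide_right_mono)
  moreover have "2 / (S + 2) \<le> 2 / s"
    using assms by (intro divide_left_mono) auto
  ultimately show ?thesis by linarith
qed

text \<open>Only departures from 0 contribute: a return turns a pending traversal into an actual one
  and leaves the value unchanged.\<close>

lemma move_potential_increment:
  assumes "y \<in> set_pmf (jump ab x)" "x \<in> {-1, 0, 1}" "u \<ge> 0" "v \<ge> 0" "fst ab + snd ab > 0"
  shows "\<bar>move_potential y (reinforce x y ab) u v - move_potential x ab u v\<bar>
         \<le> 2 / (real (fst ab) + real (snd ab))"
proof (cases "x = 0")
  case True
  then have y: "y = -1 \<or> y = 1"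
    using assms(1) set_pmf_jump[of ab x] by auto
  let ?A = "real (fst ab) + u" and ?S = "real (fst ab) + real (snd ab) + u + v"
  have "move_potential y (reinforce x y ab) u v - move_potential x ab u v
    = (?A + (if y = -1 then 2 else 0)) / (?S + 2) - ?A / ?S"
    using y True by (auto simp: move_potential_def reinforce_def at_node_def add_ac doubleton_eq_iff)
  moreover have "\<bar>\<dots>\<bar> \<le> 2 / (real (fst ab) + real (snd ab))"
    using assms by (intro ratio_increment_bound) auto
  ultimately show ?thesis by simp
next
  case False
  then have "y = 0"
    using assms(1) set_pmf_jump[of ab x] by auto
  then have "move_potential y (reinforce x y ab) u v = move_potential x ab u v"
    using assms(2) False
    by (auto simp: move_potential_def reinforce_def at_node_def add_ac insert_commute doubleton_eq_iff)
  then show ?thesis by simp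
qed

text \<open>The difference equals \<open>(u - w * (a / s)) / (s + w)\<close>, and
  \<open>a / s\<close> lies in the unit interval. It serves both to bound the drift and to compare
  the potential with the left fraction.\<close>

lemma fraction_perturbation:
  fixes a s u w :: real
  assumes "0 \<le> a" "a \<le> s" "0 < s" "0 \<le> u" "u \<le> w"
  shows "\<bar>(a + u) / (s + w) - a / s\<bar> \<le> w / s"
proof -
  have "(a + u) / (s + w) - a / s = (u - w * (a / s)) / (s + w)"
    using assms by (simp add: field_simps)
  moreover have "\<bar>u - w * (a / s)\<bar> \<le> w"
  proof -
    have "0 \<le> a / s" "a / s \<le> 1" using assms by auto
    then have "w * (a / s) \<le> w * 1" "0 \<le> w * (a / s)"
      using assms by (intro mult_left_mono mult_nonneg_nonneg; simp)+
    then show ?thesis using assms by linarith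
  qed
  then have "\<bar>(u - w * (a / s)) / (s + w)\<bar> \<le> w / (s + w)"
    using assms by (simp add: abs_divide divide_right_mono)
  moreover have "w / (s + w) \<le> w / s"
    using assms by (intro divide_left_mono) auto
  ultimately show ?thesis by linarith
qed

text \<open>A walker at 0 jumps left with probability \<open>a / s\<close>, while the potential is
  \<open>(a + u) / (s + u + v)\<close>; the drift is their difference times
  \<open>2 / (s + u + v + 2)\<close>. The difference comes from the pending return of the resting
  walker alone and is at most \<open>1 / s\<close>; with \<open>u = v = 0\<close> the drift
  vanishes, as in an urn that adds two balls.\<close>

lemma move_potential_drift:
  fixes a b :: nat and u v :: real
  assumes "x \<in> {-1, 0, 1}" "u \<ge> 0" "v \<ge> 0" "u + v \<le> 1" "a + b > 0"
  shows "\<bar>measure_pmf.expectation (jump (a, b) x)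
            (\<lambda>y. move_potential y (reinforce x y (a, b)) u v) - move_potential x (a, b) u v\<bar>
         \<le> 2 / (a + b) ^ 2"
proof (cases "x = 0")
  case True
  define s where "s = real a + real b"
  have s: "s > 0" using assms(5) by (auto simp: s_def)
  have a: "real a \<le> s" by (auto simp: s_def)
  have b: "real b = s - a" by (auto simp: s_def)
  let ?S = "s + (u + v)"
  have S: "?S > 0" using s assms by linarith
  have mp: "move_potential 1 (a, b + 1) u v = (a + u) / (?S + 2)"
    "move_potential (-1) (a + 1, b) u v = (a + u + 2) / (?S + 2)"
    "move_potential 0 (a, b) u v = (a + u) / ?S"
    by (auto simp: move_potential_def at_node_def s_def add_ac)
  have re: "reinforce 0 1 (a, b) = (a, b + 1)" "reinforce 0 (-1) (a, b) = (a + 1, b)"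
    by (auto simp: reinforce_def doubleton_eq_iff)
  have "measure_pmf.expectation (jump (a, b) x)
            (\<lambda>y. move_potential y (reinforce x y (a, b)) u v) - move_potential x (a, b) u v
      = b / s * ((a + u) / (?S + 2)) + (1 - b / s) * ((a + u + 2) / (?S + 2)) - (a + u) / ?S"
    unfolding expectation_jump True re mp by (simp add: s_def)
  also have "\<dots> = 2 * (a / s - (a + u) / ?S) / (?S + 2)"
  proof -
    \<comment> \<open>Naming the two fractions leaves only \<open>S\<close> and \<open>S + 2\<close>
      as denominators.\<close>
    define q where "q = real a / s"
    have q: "real b / s = 1 - q" using s by (simp add: q_def b field_simps)
    define S r where "S = ?S" and "r = (a + u) / ?S"
    have r: "a + u = r * S" and "S > 0" unfolding r_def S_def using S by simp_all
    have "(1 - q) * (r * S / (S + 2)) + (1 - (1 - q)) * ((r * S + 2) / (S + 2)) - r * S / S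
        = ((1 - q) * (r * S) + q * (r * S + 2)) / (S + 2) - r"
      using \<open>S > 0\<close> by (simp add: add_divide_distrib distrib_left)
    also have "\<dots> = 2 * (q - r * S / S) / (S + 2)"
      using \<open>S > 0\<close> by (simp add: field_simps)
    finally show ?thesis
      unfolding q q_def[symmetric] S_def[symmetric] r .
  qed
  also have "\<bar>\<dots>\<bar> \<le> 2 / s ^ 2"
  proof -
    have "\<bar>(a + u) / ?S - a / s\<bar> \<le> (u + v) / s"
      using assms s a by (intro fraction_perturbation) auto
    also have "\<dots> \<le> 1 / s" using assms s by (intro divide_right_mono) auto
    finally have "\<bar>a / s - (a + u) / ?S\<bar> \<le> 1 / s" by (simp only: abs_minus_commute)
    then have "2 * \<bar>a / s - (a + u) / ?S\<bar> / (?S + 2) \<le> 2 * (1 / s) / s"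
      using assms s by (intro frac_le mult_left_mono) auto
    moreover have "\<bar>2 * x / (?S + 2)\<bar> = 2 * \<bar>x\<bar> / (?S + 2)" for x
      using S by (simp add: abs_mult)
    ultimately show ?thesis by (simp only:) (simp add: power2_eq_square)
  qed
  finally show ?thesis by (simp add: s_def)
next
  case False
  then have "move_potential 0 (reinforce x 0 (a, b)) u v = move_potential x (a, b) u v"
    using assms(1)
    by (auto simp: move_potential_def reinforce_def at_node_def add_ac insert_commute doubleton_eq_iff)
  then show ?thesis using False by (simp add: expectation_jump)
qed

lemma at_node_bounds: "at_node y x \<ge> 0" "at_node (-1) x + at_node 1 x \<le> 1"
  by (auto simp: at_node_def)

lemma valid_init: "valid 0 ((0, 0), (1, 1))"
  by (simp add: valid_def)

lemma valid_step:
  assumes "valid n c" "c' \<in> set_pmf (lerrw_step c)"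
  shows "valid (Suc n) c'"
proof -
  obtain x1 x2 a b where c: "c = ((x1, x2), (a, b))"
    by (metis prod.collapse)
  show ?thesis
    using assms set_pmf_jump[of "(a, b)" x1] set_pmf_jump[of "(a, b)" x2]
    unfolding c set_pmf_lerrw_step
    by (auto simp: valid_def reinforce_def doubleton_eq_iff insert_commute split: if_splits)
qed

lemma potential_increment:
  assumes "valid n c" "c' \<in> set_pmf (lerrw_step c)"
  shows "\<bar>potential c' - potential c\<bar> \<le> 2 / (real n + 2)"
proof -
  obtain x1 x2 ab where c: "c = ((x1, x2), ab)"
    by (metis prod.collapse)
  have v: "x1 \<in> {-1, 0, 1}" "x2 \<in> {-1, 0, 1}" "fst ab + snd ab = n + 2"
    using assms(1) by (auto simp: valid_def c split: prod.splits)
  from v(3) have ab: "fst ab + snd ab > 0" "real (fst ab) + real (snd ab) = real n + 2" by linarith+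
  from assms(2) consider
    y where "y \<in> set_pmf (jump ab x1)" "c' = ((y, x2), reinforce x1 y ab)"
  | y where "y \<in> set_pmf (jump ab x2)" "c' = ((x1, y), reinforce x2 y ab)"
    unfolding c set_pmf_lerrw_step by auto
  then show ?thesis
  proof cases
    case (1 y)
    show ?thesis
      using move_potential_increment[OF 1(1) v(1) at_node_bounds(1)[of "-1" x2] at_node_bounds(1)[of 1 x2]] ab
      unfolding 1 c potential_eq_move_potential(1) by simp
  next
    case (2 y)
    show ?thesis
      using move_potential_increment[OF 2(1) v(2) at_node_bounds(1)[of "-1" x1] at_node_bounds(1)[of 1 x1]] ab
      unfolding 2 c potential_eq_move_potential(2) by simp
  qed
qed

text \<open>A step averages over the two choices of the walker, and the drift bound holds for each
  choice.\<close>

lemma potential_drift: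
  assumes "valid n c"
  shows "\<bar>measure_pmf.expectation (lerrw_step c) potential - potential c\<bar> \<le> 2 / (real n + 2) ^ 2"
proof -
  obtain x1 x2 a b where c: "c = ((x1, x2), (a, b))"
    by (metis prod.collapse)
  have v: "x1 \<in> {-1, 0, 1}" "x2 \<in> {-1, 0, 1}" and "a + b = n + 2"
    using assms(1) by (auto simp: valid_def c)
  then have ab: "a + b > 0" "real a + real b = real n + 2" by linarith+
  let ?E1 = "measure_pmf.expectation (jump (a, b) x1) (\<lambda>y. potential ((y, x2), reinforce x1 y (a, b)))"
  let ?E2 = "measure_pmf.expectation (jump (a, b) x2) (\<lambda>y. potential ((x1, y), reinforce x2 y (a, b)))"
  have "\<bar>?E1 - potential c\<bar> \<le> 2 / (real n + 2) ^ 2" "\<bar>?E2 - potential c\<bar> \<le> 2 / (real n + 2) ^ 2"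
    using move_potential_drift[OF v(1) at_node_bounds(1) at_node_bounds(1) at_node_bounds(2), of a b x2]
      move_potential_drift[OF v(2) at_node_bounds(1) at_node_bounds(1) at_node_bounds(2), of a b x1] ab
    unfolding c by (simp_all only: flip: potential_eq_move_potential)
      (simp_all add: add_ac potential_commute[of x1])
  moreover have "\<bar>x - z\<bar> \<le> d \<Longrightarrow> \<bar>y - z\<bar> \<le> d \<Longrightarrow> \<bar>(x + y) / 2 - z\<bar> \<le> d" for x y z d :: real
    unfolding abs_le_iff by (simp add: field_simps)
  ultimately show ?thesis
    unfolding c expectation_lerrw_step by blast
qed

lemma potential_bounds: "0 \<le> potential c" "potential c \<le> 1"
  by (auto simp: potential_def at_node_def divide_simps split: prod.splits)

text \<open>At most two returns are pending, against a total weight of \<open>n + 2\<close>.\<close>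

lemma potential_approx:
  assumes "valid n ((x1, x2), (a, b))"
  shows "\<bar>potential ((x1, x2), (a, b)) - a / (a + b)\<bar> \<le> 2 / (real n + 2)"
proof -
  have ab: "real a + real b = real n + 2"
    using assms by (auto simp: valid_def)
  define u w where "u = at_node (-1) x1 + at_node (-1) x2" and "w = u + at_node 1 x1 + at_node 1 x2"
  have uw: "0 \<le> u" "u \<le> w" "w \<le> 2"
    by (auto simp: u_def w_def at_node_def)
  have "\<bar>(a + u) / ((a + b) + w) - a / (a + b)\<bar> \<le> w / (real a + real b)"
    using fraction_perturbation[of a "a + b" u w] uw ab by auto
  also have "\<dots> \<le> 2 / (real n + 2)" unfolding ab using uw by (simp add: divide_right_mono add.commute)
  finally show ?thesis by (simp add: potential_def u_def w_def add_ac)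
qed

text \<open>Here \<open>y\<close> stands for the potential at an earlier time. Expanding the square
  around \<open>potential c\<close>, the cross term is at most \<open>2 * 1 * 2 / (n + 2)^2\<close>
  by the drift bound, and the squared increment adds another \<open>4 / (n + 2)^2\<close>.\<close>

lemma potential_second_moment_step:
  assumes "valid n c" "0 \<le> y" "y \<le> 1"
  shows "measure_pmf.expectation (lerrw_step c) (\<lambda>c'. (potential c' - y) ^ 2)
         \<le> (potential c - y) ^ 2 + 8 / (real n + 2) ^ 2"
proof -
  let ?E = "measure_pmf.expectation (lerrw_step c)"
  note int = integrable_measure_pmf_finite[OF finite_set_pmf_lerrw_step[of c]]
  let ?d = "\<lambda>c'. potential c' - potential c"
  have "?E (\<lambda>c'. (potential c' - y) ^ 2)
      = ?E (\<lambda>c'. (potential c - y) ^ 2 + 2 * (potential c - y) * ?d c' + (?d c') ^ 2)"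
    by (intro Bochner_Integration.integral_cong refl) (simp add: power2_eq_square algebra_simps)
  also have "\<dots> = (potential c - y) ^ 2 + 2 * (potential c - y) * (?E potential - potential c)
      + ?E (\<lambda>c'. (?d c') ^ 2)"
    by (simp add: int power2_eq_square)
  also have "?E (\<lambda>c'. (?d c') ^ 2) \<le> ?E (\<lambda>c'. (2 / (real n + 2)) ^ 2)"
  proof (intro integral_mono_AE int)
    show "AE c' in lerrw_step c. (?d c') ^ 2 \<le> (2 / (real n + 2)) ^ 2"
      using potential_increment[OF assms(1)]
      by (simp add: AE_measure_pmf_iff power2_le_iff_abs_le add.commute del: split_paired_All)
  qed
  also have "\<dots> = 4 / (real n + 2) ^ 2" by (simp add: power_divide)
  also have "2 * (potential c - y) * (?E potential - potential c) \<le> 4 / (real n + 2) ^ 2"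
  proof -
    have "\<bar>potential c - y\<bar> \<le> 1" using potential_bounds[of c] assms by linarith
    then have "\<bar>potential c - y\<bar> * \<bar>?E potential - potential c\<bar> \<le> 1 * (2 / (real n + 2) ^ 2)"
      using potential_drift[OF assms(1)] by (intro mult_mono) (auto simp: add.commute)
    then have "(potential c - y) * (?E potential - potential c) \<le> 2 / (real n + 2) ^ 2"
      by (simp flip: abs_mult)
    then show ?thesis unfolding mult.assoc by linarith
  qed
  finally show ?thesis by simp
qed

section \<open>Excursions from the state with both walkers at 0\<close>

definition both_home :: "config \<Rightarrow> bool" where
  "both_home c \<longleftrightarrow> fst c = (0, 0)"

text \<open>From two walkers away the next state has one walker away, from which the path is killed
  or returns with probability 1/2 each; the eigenvalue of this killed chain is \<open>1 / sqrt 2\<close>, and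
  the weights 3 and 4 approximate its eigenvector well enough for the rate 3/4.\<close>

definition homing :: "config \<Rightarrow> real" where
  "homing c = (if both_home c then 0 else if fst (fst c) = 0 \<or> snd (fst c) = 0 then 3 else 4)"

text \<open>With one walker away the mean is (0 + 4) / 2 = 2, below 9/4; with both away it is 3,
  exactly 3/4 of 4.\<close>

lemma homing_step:
  assumes "\<not> both_home c"
  shows "measure_pmf.expectation (lerrw_step c) homing \<le> 3 / 4 * homing c"
proof -
  obtain x1 x2 a b where c: "c = ((x1, x2), (a, b))"
    by (metis prod.collapse)
  show ?thesis
    using assms
    by (auto simp: c expectation_lerrw_step expectation_jump homing_def both_home_def)
qed

section \<open>Law of finite histories\<close>

text \<open>The support is finite, so every function is integrable, and conditioning on the past
  becomes an iterated expectation.\<close>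

primrec path_pmf :: "nat \<Rightarrow> config list pmf" where
  "path_pmf 0 = return_pmf [((0, 0), (1, 1))]"
| "path_pmf (Suc n) = bind_pmf (path_pmf n) (\<lambda>h. map_pmf (\<lambda>c. c # h) (lerrw_step (hd h)))"

lemma finite_set_pmf_path_pmf: "finite (set_pmf (path_pmf n))"
  by (induction n) (auto simp: finite_set_pmf_lerrw_step)

lemma length_path_pmf: "h \<in> set_pmf (path_pmf n) \<Longrightarrow> length h = Suc n"
  by (induction n arbitrary: h) auto

lemma valid_path_pmf: "h \<in> set_pmf (path_pmf n) \<Longrightarrow> valid n (hd h)"
  proof (induction n arbitrary: h)
  case (Suc n)
  then obtain h' c where "h = c # h'" "h' \<in> set_pmf (path_pmf n)" "c \<in> set_pmf (lerrw_step (hd h'))"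
    by auto
  with Suc.IH[of h'] valid_step[of n "hd h'" c] show ?case by simp
qed (use valid_init in simp)

text \<open>Only the past \<open>h\<close> can produce \<open>c # h\<close>, so the mixture
  collapses to one term. The product has the shape of the assumption
  \<open>transition\<close>.\<close>

lemma pmf_path_pmf_Cons:
  "pmf (path_pmf (Suc n)) (c # h) = pmf (path_pmf n) h * pmf (lerrw_step (hd h)) c"
proof -
  have "pmf (map_pmf (\<lambda>c. c # h') (lerrw_step (hd h'))) (c # h)
      = (if h' = h then pmf (lerrw_step (hd h)) c else 0)" for h'
  proof (cases "h' = h")
    case True
    then show ?thesis
      using pmf_map_inj'[of "\<lambda>c. c # h" "lerrw_step (hd h)" c] by (simp add: inj_def)
  next
    case False
    then have "c # h \<notin> set_pmf (map_pmf (\<lambda>c. c # h') (lerrw_step (hd h')))"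
      by auto
    then show ?thesis
      using False by (simp add: pmf_eq_0_set_pmf)
  qed
  then show ?thesis
    unfolding path_pmf.simps pmf_bind
    by (subst integral_measure_pmf_real[of "{h}"]) (auto split: if_splits)
qed

lemma expectation_path_pmf_Suc:
  fixes f :: "config list \<Rightarrow> real"
  shows "measure_pmf.expectation (path_pmf (Suc n)) f
    = measure_pmf.expectation (path_pmf n)
        (\<lambda>h. measure_pmf.expectation (lerrw_step (hd h)) (\<lambda>c. f (c # h)))"
  unfolding path_pmf.simps
  by (subst pmf_expectation_bind[OF finite_set_pmf_path_pmf _ subset_refl])
    (simp_all add: finite_set_pmf_lerrw_step integral_measure_pmf[OF finite_set_pmf_path_pmf[of n]])

text \<open>Tower property as an inequality: a bound given the past survives averaging. It drives
  the inductions for the squared increment and for the decay of \<open>homing\<close>.\<close>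

lemma expectation_path_pmf_Suc_le:
  fixes f g :: "config list \<Rightarrow> real"
  assumes "\<And>h. h \<in> set_pmf (path_pmf n) \<Longrightarrow>
      measure_pmf.expectation (lerrw_step (hd h)) (\<lambda>c. f (c # h)) \<le> g h"
  shows "measure_pmf.expectation (path_pmf (Suc n)) f \<le> measure_pmf.expectation (path_pmf n) g"
  unfolding expectation_path_pmf_Suc
  by (intro integral_mono_AE integrable_measure_pmf_finite finite_set_pmf_path_pmf)
    (auto simp: AE_measure_pmf_iff assms)

section \<open>Moment and decay bounds averaged over histories\<close>

text \<open>In a list distributed as \<^term>\<open>path_pmf n\<close> the time runs backwards: its \<open>i\<close>-th entry is
  the configuration at time \<open>n - i\<close>.\<close>

lemma expectation_squared_increment:
  "measure_pmf.expectation (path_pmf (n + k)) (\<lambda>h. (potential (hd h) - potential (h ! k)) ^ 2)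
   \<le> 8 * real k / (real n + 2) ^ 2"
proof (induction k)
  case 0
  have "measure_pmf.expectation (path_pmf n) (\<lambda>h. (potential (hd h) - potential (h ! 0)) ^ 2)
    = measure_pmf.expectation (path_pmf n) (\<lambda>h. 0)"
    by (intro integral_cong_AE) (auto simp: AE_measure_pmf_iff length_Suc_conv dest!: length_path_pmf)
  then show ?case by simp
next
  case (Suc k)
  let ?E = "\<lambda>k. measure_pmf.expectation (path_pmf (n + k))"
  \<comment> \<open>The reference configuration at time \<open>n\<close> moves from index
    \<open>k\<close> to index \<open>Suc k\<close> when a new head is added.\<close>
  have "?E (Suc k) (\<lambda>h. (potential (hd h) - potential (h ! Suc k)) ^ 2)
      \<le> ?E k (\<lambda>h. (potential (hd h) - potential (h ! k)) ^ 2 + 8 / (real n + 2) ^ 2)"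
    unfolding add_Suc_right
  proof (rule expectation_path_pmf_Suc_le)
    fix h assume "h \<in> set_pmf (path_pmf (n + k))"
    then have "measure_pmf.expectation (lerrw_step (hd h)) (\<lambda>c. (potential c - potential (h ! k)) ^ 2)
        \<le> (potential (hd h) - potential (h ! k)) ^ 2 + 8 / (real (n + k) + 2) ^ 2"
      by (intro potential_second_moment_step valid_path_pmf potential_bounds)
    \<comment> \<open>Each later step costs at most as much as the step at time \<open>n\<close>,
      which makes the total linear in \<open>k\<close>.\<close>
    also have "8 / (real (n + k) + 2) ^ 2 \<le> 8 / (real n + 2) ^ 2"
      by (intro divide_left_mono power_mono) auto
    finally show "measure_pmf.expectation (lerrw_step (hd h))
        (\<lambda>c. (potential (hd (c # h)) - potential ((c # h) ! Suc k)) ^ 2)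
        \<le> (potential (hd h) - potential (h ! k)) ^ 2 + 8 / (real n + 2) ^ 2"
      by (simp add: add.commute)
  qed
  also have "\<dots> = ?E k (\<lambda>h. (potential (hd h) - potential (h ! k)) ^ 2) + 8 / (real n + 2) ^ 2"
    by (simp add: integrable_measure_pmf_finite finite_set_pmf_path_pmf)
  also have "\<dots> \<le> 8 * real k / (real n + 2) ^ 2 + 8 / (real n + 2) ^ 2"
    using Suc by simp
  finally show ?case by (simp add: add_divide_distrib[symmetric] algebra_simps)
qed

text \<open>The condition says that times \<open>n + 1\<close> to \<open>n + k\<close> are all away
  from home. The configuration at time \<open>n\<close> is unrestricted, so the first step need not
  contract; hence the exponent \<open>k - 1\<close>, which is 0 also for
  \<open>k = 0\<close>.\<close>

lemma expectation_homing_decay: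
  "measure_pmf.expectation (path_pmf (n + k))
     (\<lambda>h. if \<forall>c \<in> set (take k h). \<not> both_home c then homing (hd h) else 0) \<le> 4 * (3 / 4) ^ (k - 1)"
proof (induction k)
  case 0
  have "measure_pmf.expectation (path_pmf n) (\<lambda>h. homing (hd h))
    \<le> measure_pmf.expectation (path_pmf n) (\<lambda>h. 4)"
    by (intro integral_mono_AE integrable_measure_pmf_finite finite_set_pmf_path_pmf)
      (auto simp: homing_def)
  then show ?case by simp
next
  case (Suc k)
  let ?E = "\<lambda>k. measure_pmf.expectation (path_pmf (n + k))"
  let ?f = "\<lambda>k h. if \<forall>c \<in> set (take k h). \<not> both_home c then homing (hd h) else 0"
  show ?case
  proof (cases k)
    case 0
    have "?E (Suc k) (?f (Suc k)) \<le> ?E (Suc k) (\<lambda>h. 4)"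
      by (intro integral_mono_AE integrable_measure_pmf_finite finite_set_pmf_path_pmf)
        (auto simp: homing_def)
    then show ?thesis using 0 by simp
  next
    case k: (Suc j)
    have "?E (Suc k) (?f (Suc k)) \<le> ?E k (\<lambda>h. 3 / 4 * ?f k h)"
      unfolding add_Suc_right
    proof (rule expectation_path_pmf_Suc_le)
      fix h assume h: "h \<in> set_pmf (path_pmf (n + k))"
      have f: "(\<lambda>c. ?f (Suc k) (c # h)) = (if \<forall>c \<in> set (take k h). \<not> both_home c then homing else (\<lambda>_. 0))"
        by (rule ext) (auto simp: homing_def)
      \<comment> \<open>As \<open>k\<close> is positive, the head is among the configurations known
        to be away, as \<open>homing_step\<close> requires.\<close>
      have "hd h \<in> set (take k h)"
        using length_path_pmf[OF h] k by (cases h) auto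
      then show "measure_pmf.expectation (lerrw_step (hd h)) (\<lambda>c. ?f (Suc k) (c # h)) \<le> 3 / 4 * ?f k h"
        unfolding f using homing_step by auto
    qed
    also have "\<dots> = 3 / 4 * ?E k (?f k)"
      by (rule integral_mult_right_zero)
    also have "\<dots> \<le> 3 / 4 * (4 * (3 / 4) ^ (k - 1))"
      using Suc by simp
    finally show ?thesis using k by simp
  qed
qed

section \<open>The process and the law of its histories\<close>

context two_walker_lerrw
begin

definition config :: "nat \<Rightarrow> 'a \<Rightarrow> config" where
  "config n \<omega> = ((X1 n \<omega>, X2 n \<omega>), (w n 0 \<omega>, w n 1 \<omega>))"

primrec history :: "nat \<Rightarrow> 'a \<Rightarrow> config list" where
  "history 0 \<omega> = [config 0 \<omega>]"
| "history (Suc n) \<omega> = config (Suc n) \<omega> # history n \<omega>"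

lemma length_history [simp]: "length (history n \<omega>) = Suc n"
  by (induction n) auto

lemma hd_history [simp]: "hd (history n \<omega>) = config n \<omega>"
  by (cases n) auto

lemma nth_history: "k \<le> n \<Longrightarrow> history n \<omega> ! k = config (n - k) \<omega>"
  by (induction n arbitrary: k) (auto simp: nth_Cons' Suc_diff_le)

text \<open>Translates equality of lists, newest entry first, into the condition indexed by time
  that \<open>transition\<close> uses.\<close>

lemma history_eq_iff: "length h = Suc n \<Longrightarrow> history n \<omega> = h \<longleftrightarrow> (\<forall>k\<le>n. config k \<omega> = rev h ! k)"
proof (induction n arbitrary: h)
  case 0
  then show ?case by (auto simp: length_Suc_conv)
next
  case (Suc n)
  then obtain c h' where h: "h = c # h'" "length h' = Suc n"
    by (auto simp: length_Suc_conv)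
  have "(\<forall>k\<le>Suc n. config k \<omega> = rev h ! k)
    \<longleftrightarrow> config (Suc n) \<omega> = c \<and> (\<forall>k\<le>n. config k \<omega> = rev h' ! k)"
    using h by (auto simp: le_Suc_eq nth_append)
  with Suc.IH[OF h(2)] h show ?case by auto
qed

lemma measurable_config [measurable]: "config n \<in> measurable M (count_space UNIV)"
proof -
  note [measurable] = measurable_X1 measurable_X2 measurable_w[of 0] measurable_w[of 1]
  have "(\<lambda>\<omega>. ((X1 n \<omega>, X2 n \<omega>), (w n 0 \<omega>, w n 1 \<omega>))) \<in> measurable M (count_space UNIV)"
    by measurable
  then show ?thesis unfolding config_def .
qed

lemma measurable_history [measurable]: "history n \<in> measurable M (count_space UNIV)"
proof (induction n)
  case (Suc n)
  note [measurable] = Suc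
  show ?case unfolding history.simps by measurable
qed simp

text \<open>Induction on time: \<open>init\<close> gives the base case, and
  \<open>transition\<close> multiplies by the same factor as \<open>pmf_path_pmf_Cons\<close>. Lists
  of the wrong length have mass 0 on both sides.\<close>

lemma measure_history: "measure M {\<omega> \<in> space M. history n \<omega> = h} = pmf (path_pmf n) h"
proof (induction n arbitrary: h)
  case 0
  have "AE \<omega> in M. history 0 \<omega> = [((0, 0), (1, 1))]"
    using init by (simp add: config_def)
  then have "measure M {\<omega> \<in> space M. history 0 \<omega> = h} 
    = measure M {\<omega> \<in> space M. h = [((0, 0), (1, 1))]}"
    by (intro finite_measure_eq_AE) (auto simp del: history.simps)
  then show ?case by (auto simp: prob_space indicator_def)
next
  case (Suc n)
  show ?case
  proof (cases "length h = Suc (Suc n)")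
    case False
    then have "{\<omega> \<in> space M. history (Suc n) \<omega> = h} = {}"
      using length_history by blast
    moreover have "h \<notin> set_pmf (path_pmf (Suc n))"
      using False length_path_pmf by blast
    ultimately show ?thesis by (metis measure_empty pmf_eq_0_set_pmf)
  next
    case True
    then obtain c h' where h: "h = c # h'" "length h' = Suc n"
      by (auto simp: length_Suc_conv)
    then have n: "rev h ! n = hd h'" "rev h ! Suc n = c"
      and prefix: "(\<forall>k\<le>n. config k \<omega> = rev h ! k) \<longleftrightarrow> (\<forall>k\<le>n. config k \<omega> = rev h' ! k)" for \<omega>
      by (auto simp: nth_append rev_nth length_Suc_conv)
    have "measure M {\<omega> \<in> space M. history (Suc n) \<omega> = h}
      = measure M {\<omega> \<in> space M. \<forall>k\<le>n. config k \<omega> = rev h ! k} * pmf (lerrw_step (rev h ! n)) (rev h ! Suc n)"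
      unfolding history_eq_iff[OF True] using transition[of n "\<lambda>k. rev h ! k"]
      by (simp add: config_def)
    also have "\<dots> = pmf (path_pmf n) h' * pmf (lerrw_step (hd h')) c"
      unfolding n prefix history_eq_iff[OF h(2), symmetric] Suc ..
    finally show ?thesis unfolding h pmf_path_pmf_Cons .
  qed
qed

text \<open>Histories range over a countable type, so agreement on singletons suffices. Expectations
  over \<open>M\<close> then reduce to those over \<open>path_pmf\<close>.\<close>

lemma distr_history: "distr M (count_space UNIV) (history n) = measure_pmf (path_pmf n)"
proof (rule measure_eqI_countable[where A = UNIV])
  fix h
  have "history n -` {h} \<inter> space M = {\<omega> \<in> space M. history n \<omega> = h}" by auto
  then show "emeasure (distr M (count_space UNIV) (history n)) {h} = emeasure (measure_pmf (path_pmf n)) {h}"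
    by (simp add: emeasure_distr emeasure_eq_measure measure_history emeasure_pmf_single)
qed auto

lemma expectation_history:
  fixes f :: "config list \<Rightarrow> real"
  shows "expectation (\<lambda>\<omega>. f (history n \<omega>)) = measure_pmf.expectation (path_pmf n) f"
  by (subst distr_history[symmetric], subst integral_distr) auto

lemma AE_history: "AE \<omega> in M. history n \<omega> \<in> set_pmf (path_pmf n)"
proof -
  have "AE h in distr M (count_space UNIV) (history n). h \<in> set_pmf (path_pmf n)"
    unfolding distr_history by (simp add: AE_measure_pmf)
  then show ?thesis by (subst (asm) AE_distr_iff) auto
qed

end

section \<open>Summability, interpolation between cubes, and visit times\<close>

text \<open>Exchanging sum and integral shows that the sum of the functions has finite integral,
  hence is finite almost everywhere.\<close>

lemma (in finite_measure) AE_summable_of_summable_integral: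
  fixes f :: "nat \<Rightarrow> 'a \<Rightarrow> real"
  assumes int: "\<And>i. integrable M (f i)"
    and nonneg: "\<And>i x. 0 \<le> f i x"
    and sum: "summable (\<lambda>i. integral\<^sup>L M (f i))"
  shows "AE x in M. summable (\<lambda>i. f i x)"
proof -
  have [measurable]: "f i \<in> borel_measurable M" for i
    using int by blast
  have "(\<integral>\<^sup>+x. (\<Sum>i. ennreal (f i x)) \<partial>M) = (\<Sum>i. \<integral>\<^sup>+x. ennreal (f i x) \<partial>M)"
    by (intro nn_integral_suminf) measurable
  also have "\<dots> = (\<Sum>i. ennreal (integral\<^sup>L M (f i)))"
    by (simp add: nn_integral_eq_integral int nonneg)
  also have "\<dots> = ennreal (\<Sum>i. integral\<^sup>L M (f i))"
    by (intro suminf_ennreal2 sum) (simp add: nonneg)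
  finally have "(\<integral>\<^sup>+x. (\<Sum>i. ennreal (f i x)) \<partial>M) \<noteq> \<infinity>"
    by simp
  then have "AE x in M. (\<Sum>i. ennreal (f i x)) \<noteq> \<infinity>"
    by (intro nn_integral_noteq_infinite) auto
  then show ?thesis
    by eventually_elim (simp add: nonneg summable_suminf_not_top)
qed

text \<open>With s = j + 1 the gap is 3 s^2 + 3 s + 1, and s is at least 1.\<close>

lemma cube_gap: "Suc (Suc j) ^ 3 \<le> Suc j ^ 3 + 7 * Suc j ^ 2"
  by (simp add: power3_eq_cube power2_eq_square algebra_simps)

lemma between_cubes:
  assumes "n \<ge> 1"
  shows "\<exists>j. Suc j ^ 3 \<le> n \<and> n < Suc (Suc j) ^ 3"
  using assms
proof (induction n rule: nat_induct_at_least)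
  case base
  show ?case by (rule exI[of _ 0]) (simp add: power3_eq_cube)
next
  case (Suc n)
  then obtain j where j: "Suc j ^ 3 \<le> n" "n < Suc (Suc j) ^ 3" by blast
  show ?case
  proof (cases "Suc n < Suc (Suc j) ^ 3")
    case True
    then show ?thesis using j by (intro exI[of _ j]) linarith
  next
    case False
    moreover have "Suc (Suc j) ^ 3 < Suc (Suc (Suc j)) ^ 3"
      by (intro power_strict_mono) auto
    ultimately show ?thesis using j by (intro exI[of _ "Suc j"]) simp
  qed
qed

lemma slow_increments:
  fixes x :: "nat \<Rightarrow> real"
  assumes "\<And>n. \<bar>x (Suc n) - x n\<bar> \<le> 2 / (real n + 2)"
  shows "\<bar>x (m + k) - x m\<bar> \<le> 2 * real k / (real m + 2)"
proof (induction k)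
  case (Suc k)
  have "2 / (real (m + k) + 2) \<le> 2 / (real m + 2)"
    by (intro divide_left_mono) auto
  then have "\<bar>x (Suc (m + k)) - x (m + k)\<bar> \<le> 2 / (real m + 2)"
    using assms[of "m + k"] by linarith
  then have "\<bar>x (m + Suc k) - x m\<bar> \<le> 2 * real k / (real m + 2) + 2 / (real m + 2)"
    using Suc by simp
  also have "\<dots> = 2 * real (Suc k) / (real m + 2)"
    by (simp add: add_divide_distrib[symmetric])
  finally show ?case .
qed simp

lemma convergent_via_cubes:
  fixes x :: "nat \<Rightarrow> real"
  assumes step: "\<And>n. \<bar>x (Suc n) - x n\<bar> \<le> 2 / (real n + 2)"
    and sum: "summable (\<lambda>j. \<bar>x (Suc (Suc j) ^ 3) - x (Suc j ^ 3)\<bar>)"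
  shows "convergent x"
proof -
  define y where "y j = x (Suc j ^ 3)" for j
  have "summable (\<lambda>j. y (Suc j) - y j)"
    using sum unfolding y_def by (rule summable_rabs_cancel)
  then have "convergent (\<lambda>n. \<Sum>j<n. y (Suc j) - y j)"
    by (simp add: summable_iff_convergent)
  then obtain L' where "(\<lambda>n. y n - y 0) \<longlonglongrightarrow> L'"
    by (auto simp: convergent_def sum_lessThan_telescope)
  then have "(\<lambda>n. (y n - y 0) + y 0) \<longlonglongrightarrow> L' + y 0"
    by (intro tendsto_intros)
  then obtain L where y: "y \<longlonglongrightarrow> L" by auto
  have "x \<longlonglongrightarrow> L"
  proof (rule LIMSEQ_I)
    fix e :: real assume e: "e > 0"
    obtain J1 where J1: "\<And>j. j \<ge> J1 \<Longrightarrow> \<bar>y j - L\<bar> < e / 2"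
      using LIMSEQ_D[OF y, of "e / 2"] e by auto
    \<comment> \<open>Within a gap the sequence moves by at most \<open>14 / Suc j\<close>, which
      has to be at most \<open>e / 2\<close>.\<close>
    obtain J2 :: nat where J2: "J2 > 28 / e"
      using reals_Archimedean2 by blast
    define J where "J = max J1 J2"
    have "\<bar>x n - L\<bar> < e" if n: "n \<ge> Suc J ^ 3" for n
    proof -
      have "n \<ge> 1" using n one_le_power[of "Suc J" 3] by linarith
      then obtain j where j: "Suc j ^ 3 \<le> n" "n < Suc (Suc j) ^ 3"
        using between_cubes by blast
      have "Suc J ^ 3 < Suc (Suc j) ^ 3" using n j by linarith
      then have "j \<ge> J" using power_less_imp_less_base by fastforce
      define k where "k = n - Suc j ^ 3"
      have k: "n = Suc j ^ 3 + k" "k \<le> 7 * Suc j ^ 2"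
        using j cube_gap[of j] unfolding k_def by linarith+
      have "\<bar>x n - y j\<bar> \<le> 2 * real k / (real (Suc j ^ 3) + 2)"
        unfolding k(1) y_def by (rule slow_increments[OF step])
      also have "\<dots> \<le> 2 * (7 * real (Suc j) ^ 2) / real (Suc j) ^ 3"
      proof (intro frac_le mult_left_mono)
        show "real k \<le> 7 * real (Suc j) ^ 2"
          using k(2) by (metis of_nat_le_iff of_nat_mult of_nat_numeral of_nat_power)
      qed auto
      also have "\<dots> = 14 / real (Suc j)"
        by (simp add: power3_eq_cube power2_eq_square)
      also have "\<dots> \<le> e / 2"
      proof -
        have "28 / e < real (Suc j)" using J2 \<open>j \<ge> J\<close> unfolding J_def by simp
        then show ?thesis using e by (simp add: field_simps)
      qed
      finally show ?thesis using J1[of j] \<open>j \<ge> J\<close> unfolding J_def by linarith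
    qed
    then show "\<exists>no. \<forall>n\<ge>no. norm (x n - L) < e" by auto
  qed
  then show ?thesis by (auto simp: convergent_def)
qed

text \<open>The set of later visits is nonempty, and a nonempty set in the well-order
  \<open>enat\<close> contains its infimum; so each \<open>tau\<close> after the first is itself a
  visit time beyond its predecessor.\<close>

lemma tau_finite_and_increasing:
  assumes "\<And>n. \<exists>k>n. X1 k \<omega> = 0 \<and> X2 k \<omega> = (0 :: int)"
  shows "tau X1 X2 n \<omega> \<noteq> \<infinity>" "tau X1 X2 n \<omega> < tau X1 X2 (Suc n) \<omega>"
proof -
  have step: "tau X1 X2 n \<omega> < tau X1 X2 (Suc n) \<omega> \<and> tau X1 X2 (Suc n) \<omega> \<noteq> \<infinity>"
    if fin: "tau X1 X2 n \<omega> \<noteq> \<infinity>" for n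
  proof -
    let ?S = "{enat k | k. tau X1 X2 n \<omega> < enat k \<and> X1 k \<omega> = 0 \<and> X2 k \<omega> = 0}"
    obtain m where m: "tau X1 X2 n \<omega> = enat m" using fin by auto
    then obtain k where "k > m" "X1 k \<omega> = 0" "X2 k \<omega> = 0" using assms by blast
    then have "enat k \<in> ?S" using m by auto
    then have "Inf ?S \<in> ?S" by (rule wellorder_InfI)
    then show ?thesis by auto
  qed
  show fin: "tau X1 X2 n \<omega> \<noteq> \<infinity>" for n
    by (induction n) (use step in auto)
  show "tau X1 X2 n \<omega> < tau X1 X2 (Suc n) \<omega>" using step fin by blast
qed

section \<open>Almost sure convergence and recurrence\<close>

context two_walker_lerrw
begin

text \<open>Almost every history lies in the support of \<open>path_pmf\<close>, so the bounds on
  supports hold along the trajectory, for all of the countably many times at once.\<close>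

lemma AE_path:
  "AE \<omega> in M. \<forall>n. valid n (config n \<omega>)
     \<and> \<bar>potential (config (Suc n) \<omega>) - potential (config n \<omega>)\<bar> \<le> 2 / (real n + 2)"
proof -
  have "AE \<omega> in M. valid n (config n \<omega>)
     \<and> \<bar>potential (config (Suc n) \<omega>) - potential (config n \<omega>)\<bar> \<le> 2 / (real n + 2)" for n
    using AE_history[of "Suc n"]
  proof eventually_elim
    case (elim \<omega>)
    then have h: "history n \<omega> \<in> set_pmf (path_pmf n)"
      "config (Suc n) \<omega> \<in> set_pmf (lerrw_step (config n \<omega>))"
      by auto
    have "valid n (config n \<omega>)" using valid_path_pmf[OF h(1)] by simp
    then show ?case using potential_increment h(2) by blast
  qed
  then show ?thesis by (simp add: AE_all_countable)
qed

lemma expectation_potential_increment: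
  "expectation (\<lambda>\<omega>. (potential (config (n + k) \<omega>) - potential (config n \<omega>)) ^ 2)
   \<le> 8 * real k / (real n + 2) ^ 2"
  using expectation_squared_increment[of n k]
  unfolding expectation_history[symmetric] by (simp add: nth_history)

lemma AE_convergent_potential: "AE \<omega> in M. convergent (\<lambda>n. potential (config n \<omega>))"
proof -
  define D where "D j \<omega> = potential (config (Suc (Suc j) ^ 3) \<omega>) - potential (config (Suc j ^ 3) \<omega>)"
    for j \<omega>
  have D_bound: "\<bar>D j \<omega>\<bar> \<le> 1" for j \<omega>
    using potential_bounds[of "config (Suc (Suc j) ^ 3) \<omega>"] potential_bounds[of "config (Suc j ^ 3) \<omega>"]
    unfolding D_def by linarith
  have [measurable]: "D j \<in> borel_measurable M" for j
    unfolding D_def by measurable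
  have summ: "summable (\<lambda>j. 1 / real (Suc j) ^ 2)"
    using summable_Suc_iff[of "\<lambda>j. 1 / real j ^ 2"] inverse_power_summable[of 2, where 'a = real]
    by (simp add: inverse_eq_divide)
  \<comment> \<open>The second moment of \<open>D j\<close> is of order
    \<open>1 / Suc j ^ 4\<close>, so the weight \<open>Suc j ^ 2\<close> still leaves a summable
    sequence.\<close>
  have "AE \<omega> in M. summable (\<lambda>j. real (Suc j) ^ 2 * (D j \<omega>) ^ 2)"
  proof (rule AE_summable_of_summable_integral)
    show int: "integrable M (\<lambda>\<omega>. real (Suc j) ^ 2 * (D j \<omega>) ^ 2)" for j
    proof (intro integrable_mult_right integrable_const_bound[where B = 1])
      show "AE \<omega> in M. norm ((D j \<omega>) ^ 2) \<le> 1"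
        using D_bound by (auto simp: abs_square_le_1)
    qed measurable
    have "expectation (\<lambda>\<omega>. real (Suc j) ^ 2 * (D j \<omega>) ^ 2) \<le> 56 * (1 / real (Suc j) ^ 2)" for j
    proof -
      define k where "k = Suc (Suc j) ^ 3 - Suc j ^ 3"
      have "Suc j ^ 3 \<le> Suc (Suc j) ^ 3" by (intro power_mono) auto
      then have k: "Suc (Suc j) ^ 3 = Suc j ^ 3 + k" "k \<le> 7 * Suc j ^ 2"
        using cube_gap[of j] unfolding k_def by linarith+
      have "expectation (\<lambda>\<omega>. (D j \<omega>) ^ 2) \<le> 8 * real k / (real (Suc j ^ 3) + 2) ^ 2"
        unfolding D_def k(1) by (rule expectation_potential_increment)
      also have "\<dots> \<le> 8 * (7 * real (Suc j) ^ 2) / (real (Suc j) ^ 3) ^ 2"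
      proof (intro frac_le mult_left_mono power_mono)
        show "real k \<le> 7 * real (Suc j) ^ 2"
          using k(2) by (metis of_nat_le_iff of_nat_mult of_nat_numeral of_nat_power)
      qed auto
      finally have "real (Suc j) ^ 2 * expectation (\<lambda>\<omega>. (D j \<omega>) ^ 2)
        \<le> real (Suc j) ^ 2 * (8 * (7 * real (Suc j) ^ 2) / (real (Suc j) ^ 3) ^ 2)"
        by (intro mult_left_mono) auto
      also have "\<dots> = 56 * (1 / real (Suc j) ^ 2)"
      proof -
        have "s ^ 2 * (8 * (7 * s ^ 2) / (s ^ 3) ^ 2) = 56 * (1 / s ^ 2)" if "s \<noteq> 0" for s :: real
          using that by (simp add: divide_simps power3_eq_cube power2_eq_square)
        then show ?thesis using of_nat_neq_0 by blast
      qed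
      finally show ?thesis by simp
    qed
    then show "summable (\<lambda>j. expectation (\<lambda>\<omega>. real (Suc j) ^ 2 * (D j \<omega>) ^ 2))"
      by (intro summable_comparison_test'[OF summable_mult[OF summ, of 56], of 0])
        (auto simp: abs_of_nonneg)
  qed simp
  with AE_path show ?thesis
  proof eventually_elim
    case (elim \<omega>)
    have "summable (\<lambda>j. \<bar>D j \<omega>\<bar>)"
    proof (rule summable_comparison_test'[OF summable_add[OF elim(2) summ]])
      fix j :: nat
      \<comment> \<open>The square gives the bound even for
        \<open>2 * \<bar>D j \<omega>\<bar>\<close>, trading the weighted square of
        \<open>D j\<close> against a summable remainder.\<close>
      have "0 \<le> (real (Suc j) * \<bar>D j \<omega>\<bar> - 1 / real (Suc j)) ^ 2" by simp
      also have "\<dots> = (real (Suc j) ^ 2 * (D j \<omega>) ^ 2 + 1 / real (Suc j) ^ 2) - 2 * \<bar>D j \<omega>\<bar>"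
        by (simp add: power2_diff power_mult_distrib power_divide)
      finally show "norm \<bar>D j \<omega>\<bar> \<le> real (Suc j) ^ 2 * (D j \<omega>) ^ 2 + 1 / real (Suc j) ^ 2"
        by simp
    qed
    then show ?case
      using elim(1) unfolding D_def by (intro convergent_via_cubes) auto
  qed
qed

lemma AE_convergent_left_fraction: "AE \<omega> in M. convergent (\<lambda>n. left_fraction w n \<omega>)"
  using AE_convergent_potential AE_path
proof eventually_elim
  case (elim \<omega>)
  have "(\<lambda>n. potential (config n \<omega>) - left_fraction w n \<omega>) \<longlonglongrightarrow> 0"
  proof (rule Lim_null_comparison)
    show "\<forall>\<^sub>F n in sequentially.
        norm (potential (config n \<omega>) - left_fraction w n \<omega>) \<le> 2 / (real n + 2)"
      using elim(2) potential_approx unfolding config_def left_fraction_def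
      by (auto intro!: always_eventually)
    show "(\<lambda>n. 2 / (real n + 2)) \<longlonglongrightarrow> 0"
      using LIMSEQ_ignore_initial_segment[OF lim_const_over_n[of "2 :: real"], of 2] by (simp add: add.commute)
  qed
  moreover obtain L where "(\<lambda>n. potential (config n \<omega>)) \<longlonglongrightarrow> L"
    using elim(1) by (auto simp: convergent_def)
  ultimately have "(\<lambda>n. potential (config n \<omega>) - (potential (config n \<omega>) - left_fraction w n \<omega>)) \<longlonglongrightarrow> L - 0"
    by (intro tendsto_diff)
  then show ?case by (auto intro: convergentI)
qed

text \<open>If no visit occurs after \<open>n\<close>, then \<open>homing\<close> at time
  \<open>n + Suc k\<close> is at least 1, so the probability of this event is at most the decaying
  expectation, for every \<open>k\<close>.\<close>

lemma AE_home_again: "AE \<omega> in M. \<exists>i>n. X1 i \<omega> = 0 \<and> X2 i \<omega> = 0"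
proof -
  have "AE \<omega> in M. \<exists>i>n. both_home (config i \<omega>)"
  proof -
    let ?N = "{\<omega> \<in> space M. \<forall>i>n. \<not> both_home (config i \<omega>)}"
    have N [measurable]: "?N \<in> sets M" by measurable
    have bound: "prob ?N \<le> 4 * (3 / 4) ^ k" for k
    proof -
      let ?f = "\<lambda>h. if \<forall>c \<in> set (take (Suc k) h). \<not> both_home c then homing (hd h) else 0"
      have "prob ?N = expectation (indicator ?N)"
        by simp
      also have "\<dots> \<le> expectation (\<lambda>\<omega>. ?f (history (n + Suc k) \<omega>))"
      proof (intro integral_mono)
        show "integrable M (indicator ?N :: 'a \<Rightarrow> real)"
          using N by (simp add: integrable_indicator_iff emeasure_eq_measure)
        show "integrable M (\<lambda>\<omega>. ?f (history (n + Suc k) \<omega>))"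
          by (intro integrable_const_bound[where B = 4]) (auto simp: homing_def)
        fix \<omega>
        have "(\<forall>c \<in> set (take (Suc k) (history (n + Suc k) \<omega>)). \<not> both_home c)
            \<and> homing (hd (history (n + Suc k) \<omega>)) \<ge> 1"
          if "\<omega> \<in> ?N"
        proof -
          from that have away: "\<not> both_home (config i \<omega>)" if "i > n" for i
            using \<open>i > n\<close> by blast
          \<comment> \<open>Index \<open>i\<close> of this history is time
            \<open>n + Suc k - i\<close>, which exceeds \<open>n\<close> exactly for
            \<open>i < Suc k\<close>.\<close>
          have "\<not> both_home (history (n + Suc k) \<omega> ! i)" if "i < Suc k" for i
            using that away[of "n + Suc k - i"] by (simp add: nth_history del: history.simps)
          then have "\<forall>c \<in> set (take (Suc k) (history (n + Suc k) \<omega>)). \<not> both_home c"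
          proof (intro ballI)
            fix c assume "c \<in> set (take (Suc k) (history (n + Suc k) \<omega>))"
            then obtain i where "i < Suc k" "c = history (n + Suc k) \<omega> ! i"
              unfolding in_set_conv_nth by (auto simp del: history.simps)
            with \<open>\<And>i. i < Suc k \<Longrightarrow> \<not> both_home (history (n + Suc k) \<omega> ! i)\<close>
            show "\<not> both_home c" by blast
          qed
          moreover have "homing (config (n + Suc k) \<omega>) \<ge> 1"
            using away[of "n + Suc k"] by (simp add: homing_def)
          ultimately show ?thesis by (simp only: hd_history)
        qed
        then show "indicator ?N \<omega> \<le> ?f (history (n + Suc k) \<omega>)"
          by (auto simp: indicator_def homing_def simp del: history.simps)
      qed
      also have "\<dots> \<le> 4 * (3 / 4) ^ k"
        using expectation_homing_decay[of n "Suc k"]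
        unfolding expectation_history[of ?f "n + Suc k"] diff_Suc_1 .
      finally show ?thesis .
    qed
    have "(\<lambda>k. 4 * (3 / 4 :: real) ^ k) \<longlonglongrightarrow> 4 * 0"
      by (intro tendsto_intros) auto
    then have "prob ?N \<le> 4 * 0"
      by (rule LIMSEQ_le_const) (use bound in blast)
    then have "prob ?N = 0" by (simp add: measure_le_0_iff)
    with N show ?thesis
      by (subst (asm) prob_eq_0) (auto simp: not_less)
  qed
  then show ?thesis by (simp add: both_home_def config_def)
qed

end

theorem corollary5p9:
  fixes M :: "'a measure"
    and X1 X2 :: "nat \<Rightarrow> 'a \<Rightarrow> int"
    and w :: "nat \<Rightarrow> nat \<Rightarrow> 'a \<Rightarrow> nat"
  assumes "two_walker_lerrw M X1 X2 w"
  shows "\<exists>Y \<in> borel_measurable M.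
           (AE \<omega> in M. (\<lambda>n. left_fraction w n \<omega>) \<longlonglongrightarrow> (Y \<omega> :: real)) \<and>
           (AE \<omega> in M. (\<forall>n. tau X1 X2 n \<omega> \<noteq> \<infinity>) \<and>
              (\<lambda>n. left_fraction w (the_enat (tau X1 X2 n \<omega>)) \<omega>) \<longlonglongrightarrow> Y \<omega>)"
proof -
  interpret two_walker_lerrw M X1 X2 w by fact
  \<comment> \<open>Defining the limit by \<open>lim\<close> makes it measurable on the whole space;
    it is the actual limit wherever the sequence converges.\<close>
  let ?Y = "\<lambda>\<omega>. lim (\<lambda>n. left_fraction w n \<omega>)"
  note [measurable] = measurable_w[of 0] measurable_w[of 1]
  have [measurable]: "left_fraction w n \<in> borel_measurable M" for n
    unfolding left_fraction_def by measurable
  have lim: "AE \<omega> in M. (\<lambda>n. left_fraction w n \<omega>) \<longlonglongrightarrow> ?Y \<omega>"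
    using AE_convergent_left_fraction by eventually_elim (simp add: convergent_LIMSEQ_iff)
  have "AE \<omega> in M. \<forall>n. \<exists>i>n. X1 i \<omega> = 0 \<and> X2 i \<omega> = 0"
    using AE_home_again by (simp add: AE_all_countable)
  with lim have "AE \<omega> in M. (\<forall>n. tau X1 X2 n \<omega> \<noteq> \<infinity>) \<and>
      (\<lambda>n. left_fraction w (the_enat (tau X1 X2 n \<omega>)) \<omega>) \<longlonglongrightarrow> ?Y \<omega>"
  proof eventually_elim
    case (elim \<omega>)
    then have home: "\<And>n. \<exists>k>n. X1 k \<omega> = 0 \<and> X2 k \<omega> = 0" by blast
    note tau = tau_finite_and_increasing[of X1 \<omega> X2, OF home]
    \<comment> \<open>Finite, strictly increasing times select a subsequence of the convergent left
      fraction, so the limit is the same.\<close>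
    have "strict_mono (\<lambda>n. the_enat (tau X1 X2 n \<omega>))"
      unfolding strict_mono_Suc_iff
    proof
      fix n
      obtain a b where "tau X1 X2 n \<omega> = enat a" "tau X1 X2 (Suc n) \<omega> = enat b"
        using tau(1) by (metis not_infinity_eq)
      with tau(2)[of n] show "the_enat (tau X1 X2 n \<omega>) < the_enat (tau X1 X2 (Suc n) \<omega>)"
        by (simp del: tau.simps)
    qed
    from LIMSEQ_subseq_LIMSEQ[OF elim(1) this] tau(1) show ?case
      by (simp add: o_def)
  qed
  with lim show ?thesis by (intro bexI[of _ ?Y]) auto
qed

end
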